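(* Let $\{V_i\}_{i=1}^6$, $g_{ij}:V_i\cap V_j\to\mathbb{R}$ and $h_{ijk}:V_i\cap V_j\cap V_k\to\mathbb{Z}\times\mathbb{R}/\mathbb{Z}$ be the open cover of $S^2$ and the smooth maps defining the categorical Hopf map, and let $\widetilde F_0:\mathbb{R}\to S^1=U(1)$, $\widetilde F_0(r)=(\cos 2\pi r,\sin 2\pi r)$, and $\widetilde F_1:\mathbb{Z}\times\mathbb{R}/\mathbb{Z}\to\{\mathbf{1}\}$ be the trivial map. Then $$g'_{ij}=\widetilde F_0\circ g_{ij},\qquad h'_{ijk}=\widetilde F_1\circ h_{ijk}$$ determine the transition data of the Hopf map $\eta:S^3\to S^2$; that is, they are cocycle data on $S^2$ for the principal $U(1)$-bundle $\eta$.
   Context: The cover of $S^2\subset\mathbb{R}^3$: $V_1=\{X>0\}$, $V_2=\{X<0\}$, $V_3=\{Y>0\}$, $V_4=\{Y<0\}$, $V_5=\{Z>0\}$, $V_6=\{Z<0\}$. With $\arcsin$ valued in $(-\pi/2,\pi/2)$, $\arccos$ in $(0,\pi)$ and $\varrho=\sqrt{X^2+Y^2}$: $g_{15}=\frac1{2\pi}\arcsin(Y/\varrho)$, $g_{25}=\frac1{2\pi}\arcsin(-Y/\varrho)+\frac12$, $g_{35}=\frac1{2\pi}\arccos(X/\varrho)$, $g_{45}=\frac1{2\pi}\arccos(-X/\varrho)+\frac12$, $g_{5i}=-g_{i5}$ for $i=1,2,3,4$, and all other $g_{ij}$ are $0$. The maps $h_{ijk}=(g_{ik}-g_{ij}-g_{jk},[0])$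 have integer first component and second component always zero. The group $U(1)$ is regarded as a strict categorical group with only identity morphisms, with crossed module $(U(1),\{\mathbf{1}\})$ and trivial structure maps. Cocycle data $(V_i,g'_{ij},h'_{ijk})$ for it (with $g'_{ii}=1$, $g'_{ij}g'_{jk}=g'_{ik}$, and $h'_{ijk}$ trivial) are transition functions of a principal $U(1)$-bundle over $S^2$. The Hopf map: $S^3=\{(z_1,z_2)\in\mathbb{C}^2:|z_1|^2+|z_2|^2=1\}$ and $\eta(z_1,z_2)=[z_1:z_2]\in\mathbb{CP}^1\cong S^2$, where $(X,Y,Z)\ne(0,0,1)$ corresponds to $[\frac{X}{1-Z}+\frac{Y}{1-Z}i:1]$ and $(0,0,1)$ to $[1:0]$. It is a principal $U(1)$-bundle over $S^2$; in terms of local trivialisation data, with $V_N=\{z_1\ne0\}$ and $V_S=\{z_2\neq0\}$, its transition function on $V_N\cap V_S$ is $[z_1:z_2]\mapsto\frac{z_1}{z_2}\left|\frac{z_2}{z_1}\right|\in U(1)$. By convention it corresponds to the positive generator $1$ of $H^2(S^2;\mathbb{Z})\cong\mathbb{Z}$. *)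

theory Defs
  imports "HOL-Analysis.Analysis"
begin

section \<open>Smooth maps between subsets of Euclidean spaces\<close>

text \<open>\<open>Ck_on n U f\<close>: \<open>f\<close> is \<open>n\<close> times continuously differentiable on the open set \<open>U\<close>. In finite
  dimension the derivative is \<open>C\<^sup>n\<close> iff all directional derivatives are.\<close>

primrec Ck_on :: "nat \<Rightarrow> 'a::euclidean_space set \<Rightarrow> ('a \<Rightarrow> 'b::real_normed_vector) \<Rightarrow> bool" where
  "Ck_on 0 U f \<longleftrightarrow> continuous_on U f"
| "Ck_on (Suc n) U f \<longleftrightarrow>
     (\<exists>f'. (\<forall>x\<in>U. (f has_derivative f' x) (at x)) \<and> (\<forall>v. Ck_on n U (\<lambda>x. f' x v)))"

text \<open>A map on an arbitrary subset is smooth if it locally extends to a smooth map on an open set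
  of the ambient space. For embedded submanifolds (here: open subsets of \<open>S\<^sup>2\<close>, \<open>S\<^sup>3\<close>, and products
  of these with \<open>U(1)\<close>) this is smoothness in the sense of manifolds.\<close>

definition smooth_map_on :: "'a::euclidean_space set \<Rightarrow> ('a \<Rightarrow> 'b::real_normed_vector) \<Rightarrow> bool" where
  "smooth_map_on A f \<longleftrightarrow>
     (\<forall>x\<in>A. \<exists>U F. open U \<and> x \<in> U \<and> (\<forall>n. Ck_on n U F) \<and> (\<forall>y\<in>A \<inter> U. F y = f y))"

definition diffeomorphism_on ::
    "'a::euclidean_space set \<Rightarrow> 'b::euclidean_space set \<Rightarrow> ('a \<Rightarrow> 'b) \<Rightarrow> bool" where
  "diffeomorphism_on A B f \<longleftrightarrow>
     bij_betw f A B \<and> smooth_map_on A f \<and> smooth_map_on B (inv_into A f)"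


section \<open>Principal \<open>U(1)\<close>-bundles and their transition functions\<close>

definition U1 :: "complex set" where
  "U1 = {u. cmod u = 1}"

text \<open>A local trivialisation over \<open>W\<close>: a \<open>U(1)\<close>-equivariant diffeomorphism
  \<open>\<pi>\<^sup>-\<^sup>1(W) \<rightarrow> W \<times> U(1)\<close> over \<open>W\<close>. The structure group acts on the total space from the right
  by \<open>act\<close>.\<close>

definition U1_local_trivialisation ::
    "'p::euclidean_space set \<Rightarrow> ('p \<Rightarrow> complex \<Rightarrow> 'p) \<Rightarrow> ('p \<Rightarrow> 'm::euclidean_space)
      \<Rightarrow> 'm set \<Rightarrow> ('p \<Rightarrow> 'm \<times> complex) \<Rightarrow> bool" where
  "U1_local_trivialisation P act \<pi> W \<psi> \<longleftrightarrow>
     diffeomorphism_on {p \<in> P. \<pi> p \<in> W} (W \<times> U1) \<psi> \<and>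
     (\<forall>p\<in>P. \<pi> p \<in> W \<longrightarrow> fst (\<psi> p) = \<pi> p \<and>
        (\<forall>u\<in>U1. snd (\<psi> (act p u)) = snd (\<psi> p) * u))"

definition principal_U1_bundle ::
    "'p::euclidean_space set \<Rightarrow> ('p \<Rightarrow> complex \<Rightarrow> 'p) \<Rightarrow> ('p \<Rightarrow> 'm::euclidean_space)
      \<Rightarrow> 'm set \<Rightarrow> bool" where
  "principal_U1_bundle P act \<pi> M \<longleftrightarrow>
     \<pi> ` P = M \<and> smooth_map_on P \<pi> \<and>
     smooth_map_on (P \<times> U1) (\<lambda>(p, u). act p u) \<and>
     (\<forall>p\<in>P. act p 1 = p \<and>
        (\<forall>u\<in>U1. act p u \<in> P \<and> \<pi> (act p u) = \<pi> p \<and>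
           (\<forall>v\<in>U1. act (act p u) v = act p (u * v)))) \<and>
     (\<forall>x\<in>M. \<exists>W \<psi>. openin (top_of_set M) W \<and> x \<in> W \<and>
        U1_local_trivialisation P act \<pi> W \<psi>)"

text \<open>The functions \<open>g\<^sub>i\<^sub>j\<close> on \<open>V\<^sub>i \<inter> V\<^sub>j\<close> are the transition functions of the bundle with respect to
  some choice of local trivialisations \<open>\<psi>\<^sub>i\<close> over the \<open>V\<^sub>i\<close>. The index convention is that \<open>g\<^sub>i\<^sub>j\<close> leads
  from the \<open>i\<close>-th to the \<open>j\<close>-th trivialisation, \<open>\<psi>\<^sub>j (\<psi>\<^sub>i\<^sup>-\<^sup>1 (x, u)) = (x, g\<^sub>i\<^sub>j x * u)\<close>.
  (The opposite convention replaces every \<open>g\<^sub>i\<^sub>j\<close> by \<open>g\<^sub>j\<^sub>i\<close>, its inverse.)\<close>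

definition U1_transition_functions ::
    "'p::euclidean_space set \<Rightarrow> ('p \<Rightarrow> complex \<Rightarrow> 'p) \<Rightarrow> ('p \<Rightarrow> 'm::euclidean_space)
      \<Rightarrow> 'i set \<Rightarrow> ('i \<Rightarrow> 'm set) \<Rightarrow> ('i \<Rightarrow> 'i \<Rightarrow> 'm \<Rightarrow> complex) \<Rightarrow> bool" where
  "U1_transition_functions P act \<pi> I V g \<longleftrightarrow>
     (\<exists>\<psi>. (\<forall>i\<in>I. U1_local_trivialisation P act \<pi> (V i) (\<psi> i)) \<and>
        (\<forall>i\<in>I. \<forall>j\<in>I. \<forall>p\<in>P. \<pi> p \<in> V i \<inter> V j \<longrightarrow>
           snd (\<psi> j p) = g i j (\<pi> p) * snd (\<psi> i p)))"

text \<open>Cocycle data on \<open>M\<close> for the crossed module \<open>(U(1), {1})\<close> with trivial structure maps; the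
  trivial group \<open>{1}\<close> is realised as the trivial subgroup of the multiplicative group of \<open>\<complex>\<close>.\<close>

definition U1_cocycle_data ::
    "'m::euclidean_space set \<Rightarrow> 'i set \<Rightarrow> ('i \<Rightarrow> 'm set) \<Rightarrow> ('i \<Rightarrow> 'i \<Rightarrow> 'm \<Rightarrow> complex)
      \<Rightarrow> ('i \<Rightarrow> 'i \<Rightarrow> 'i \<Rightarrow> 'm \<Rightarrow> complex) \<Rightarrow> bool" where
  "U1_cocycle_data M I V g h \<longleftrightarrow>
     (\<forall>i\<in>I. openin (top_of_set M) (V i)) \<and> (\<Union>i\<in>I. V i) = M \<and>
     (\<forall>i\<in>I. \<forall>j\<in>I. g i j \<in> V i \<inter> V j \<rightarrow> U1 \<and> smooth_map_on (V i \<inter> V j) (g i j)) \<and>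
     (\<forall>i\<in>I. \<forall>j\<in>I. \<forall>k\<in>I. h i j k \<in> V i \<inter> V j \<inter> V k \<rightarrow> {1} \<and>
        smooth_map_on (V i \<inter> V j \<inter> V k) (h i j k)) \<and>
     (\<forall>i\<in>I. \<forall>x\<in>V i. g i i x = 1) \<and>
     (\<forall>i\<in>I. \<forall>j\<in>I. \<forall>k\<in>I. \<forall>x\<in>V i \<inter> V j \<inter> V k. g i j x * g j k x = g i k x)"


section \<open>The Hopf map\<close>

definition S2 :: "(real^3) set" where
  "S2 = sphere 0 1"

definition S3 :: "(complex \<times> complex) set" where
  "S3 = {(z1, z2). (cmod z1)\<^sup>2 + (cmod z2)\<^sup>2 = 1}"

text \<open>The point \<open>[a : b]\<close> of the complex projective line, as a punctured line through the origin.\<close>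

definition homog :: "complex \<Rightarrow> complex \<Rightarrow> (complex \<times> complex) set" where
  "homog a b = {(c * a, c * b) | c. c \<noteq> 0}"

definition CP1 :: "(complex \<times> complex) set set" where
  "CP1 = {homog a b | a b. (a, b) \<noteq> (0, 0)}"

definition S2_to_CP1 :: "real^3 \<Rightarrow> (complex \<times> complex) set" where
  "S2_to_CP1 p =
     (if p = vector [0, 0, 1] then homog 1 0
      else homog (Complex (p$1 / (1 - p$3)) (p$2 / (1 - p$3))) 1)"

definition hopf_map :: "complex \<times> complex \<Rightarrow> real^3" where
  "hopf_map = (\<lambda>(z1, z2). inv_into S2 S2_to_CP1 (homog z1 z2))"

definition hopf_action :: "complex \<times> complex \<Rightarrow> complex \<Rightarrow> complex \<times> complex" where
  "hopf_action = (\<lambda>(z1, z2) u. (z1 * u, z2 * u))"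

lemma homog_eq_iff:
  assumes "(a, b) \<noteq> (0, 0)" "(a', b') \<noteq> (0, 0)"
  shows "homog a b = homog a' b' \<longleftrightarrow> a * b' = a' * b"
proof
  assume "homog a b = homog a' b'"
  moreover have "(a, b) \<in> homog a b"
    unfolding homog_def by (rule CollectI, rule exI[of _ 1]) simp
  ultimately have "(a, b) \<in> homog a' b'" by simp
  then obtain c where "a = c * a'" "b = c * b'"
    unfolding homog_def by blast
  thus "a * b' = a' * b" by simp
next
  assume *: "a * b' = a' * b"
  obtain d where d: "d \<noteq> 0" "a' = d * a" "b' = d * b"
  proof (cases "a = 0")
    case True
    then have "b \<noteq> 0" "a' = 0" "b' \<noteq> 0" using * assms by auto
    then show ?thesis using True by (intro that[of "b' / b"]) auto
  next
    case False
    then have "a' \<noteq> 0" using * assms by fastforce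
    moreover have "b' = a' / a * b" using False * by (simp add: nonzero_eq_divide_eq mult.commute)
    ultimately show ?thesis using False by (intro that[of "a' / a"]) simp_all
  qed
  show "homog a b = homog a' b'"
  proof (intro equalityI subsetI)
    fix x assume "x \<in> homog a b"
    then obtain c where c: "c \<noteq> 0" "x = (c * a, c * b)" by (auto simp: homog_def)
    have "x = ((c / d) * a', (c / d) * b')"
      unfolding c(2) d(2,3) using d(1) by simp
    moreover have "c / d \<noteq> 0" using c(1) d(1) by simp
    ultimately show "x \<in> homog a' b'" unfolding homog_def by blast
  next
    fix x assume "x \<in> homog a' b'"
    then obtain c where c: "c \<noteq> 0" "x = (c * a', c * b')" by (auto simp: homog_def)
    have "x = ((c * d) * a, (c * d) * b)"
      unfolding c(2) d(2,3) by simp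
    moreover have "c * d \<noteq> 0" using c(1) d(1) by simp
    ultimately show "x \<in> homog a b" unfolding homog_def by blast
  qed
qed

lemma S2_iff: "p \<in> S2 \<longleftrightarrow> (p$1)\<^sup>2 + (p$2)\<^sup>2 + (p$3)\<^sup>2 = 1"
  by (simp add: S2_def norm_vec_def L2_set_def sum_3)

lemma S2_north_iff:
  assumes "p \<in> S2"
  shows "p = vector [0, 0, 1] \<longleftrightarrow> p$3 = 1"
  using assms by (auto simp: S2_iff vec_eq_iff forall_3)

lemma inj_on_S2_to_CP1: "inj_on S2_to_CP1 S2"
proof (rule inj_onI)
  fix p q assume p: "p \<in> S2" and q: "q \<in> S2" and eq: "S2_to_CP1 p = S2_to_CP1 q"
  show "p = q"
  proof (cases "p$3 = 1 \<or> q$3 = 1")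
    case True
    then have "p$3 = 1" "q$3 = 1"
      using eq p q by (auto simp: S2_to_CP1_def S2_north_iff homog_eq_iff split: if_splits)
    then show ?thesis
      using S2_north_iff[OF p] S2_north_iff[OF q] by simp
  next
    case False
    define s t where "s = 1 - p$3" and "t = 1 - q$3"
    have st: "s \<noteq> 0" "t \<noteq> 0" using False by (auto simp: s_def t_def)
    have 1: "p$1 / s = q$1 / t" and 2: "p$2 / s = q$2 / t"
      using eq False p q
      by (auto simp: S2_to_CP1_def S2_north_iff homog_eq_iff s_def t_def)
    have norm: "(a / (1 - c))\<^sup>2 + (b / (1 - c))\<^sup>2 = 2 / (1 - c) - 1"
      if "a\<^sup>2 + b\<^sup>2 + c\<^sup>2 = 1" "1 - c \<noteq> 0" for a b c :: real
    proof -
      have "a\<^sup>2 + b\<^sup>2 = (2 / (1 - c) - 1) * (1 - c)\<^sup>2"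
      proof -
        have "(2 / (1 - c) - 1) * (1 - c)\<^sup>2 = (2 - (1 - c)) * (1 - c)"
          using that(2) by (simp add: field_simps power2_eq_square)
        with that(1) show ?thesis by (simp add: algebra_simps power2_eq_square)
      qed
      then show ?thesis
        using that(2) by (simp add: power_divide add_divide_distrib[symmetric])
    qed
    have "2 / s - 1 = 2 / t - 1"
      using norm[of "p$1" "p$2" "p$3"] norm[of "q$1" "q$2" "q$3"] p q 1 2 st
      by (simp add: S2_iff s_def t_def)
    then have "s = t" using st by (simp add: field_simps)
    then have "p$1 = q$1" "p$2 = q$2" "p$3 = q$3"
      using 1 2 st(2) by (simp_all add: s_def t_def)
    then show ?thesis by (simp add: vec_eq_iff forall_3)
  qed
qed

lemma S2_to_CP1_hopf_coordinates:
  assumes "(z1, z2) \<in> S3"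
  defines "p \<equiv> vector [2 * Re (z1 * cnj z2), 2 * Im (z1 * cnj z2), (cmod z1)\<^sup>2 - (cmod z2)\<^sup>2]"
  shows "p \<in> S2" and "S2_to_CP1 p = homog z1 z2"
proof -
  have n: "(cmod z1)\<^sup>2 + (cmod z2)\<^sup>2 = 1" using assms(1) by (simp add: S3_def)
  have "(Re (z1 * cnj z2))\<^sup>2 + (Im (z1 * cnj z2))\<^sup>2 = (cmod z1)\<^sup>2 * (cmod z2)\<^sup>2"
    by (metis cmod_power2 complex_mod_cnj norm_mult power_mult_distrib)
  then have "(p$1)\<^sup>2 + (p$2)\<^sup>2 + (p$3)\<^sup>2 = ((cmod z1)\<^sup>2 + (cmod z2)\<^sup>2)\<^sup>2"
    by (simp add: p_def power_mult_distrib power2_sum power2_diff)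
  then show p: "p \<in> S2" using n by (simp add: S2_iff)
  have s: "1 - p$3 = 2 * (cmod z2)\<^sup>2" using n by (simp add: p_def)
  show "S2_to_CP1 p = homog z1 z2"
  proof (cases "z2 = 0")
    case True
    then have "p = vector [0, 0, 1]" using n by (simp add: p_def)
    moreover have "homog 1 0 = homog z1 z2" using True n by (subst homog_eq_iff) auto
    ultimately show ?thesis by (simp add: S2_to_CP1_def)
  next
    case False
    then have "p \<noteq> vector [0, 0, 1]" using s p by (auto simp: S2_north_iff)
    moreover have "Complex (p$1 / (1 - p$3)) (p$2 / (1 - p$3)) = z1 / z2"
    proof -
      have "Complex (p$1 / (1 - p$3)) (p$2 / (1 - p$3))
          = Complex (Re (z1 * cnj z2) / (cmod z2)\<^sup>2) (Im (z1 * cnj z2) / (cmod z2)\<^sup>2)"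
        unfolding s by (simp only: p_def vector_3 mult_divide_mult_cancel_left)
      also have "\<dots> = z1 * cnj z2 / of_real ((cmod z2)\<^sup>2)"
        by (simp only: complex_eq_iff complex.sel Re_divide_of_real Im_divide_of_real)
      also have "\<dots> = z1 / z2"
        by (rule complex_div_cnj[symmetric])
      finally show ?thesis .
    qed
    moreover have "homog (z1 / z2) 1 = homog z1 z2"
      using False by (subst homog_eq_iff) auto
    ultimately show ?thesis unfolding S2_to_CP1_def by simp
  qed
qed

lemma bij_betw_S2_CP1: "bij_betw S2_to_CP1 S2 CP1"
proof -
  have *: "homog a b \<in> CP1" if "a \<noteq> 0 \<or> b \<noteq> 0" for a b
    using that unfolding CP1_def by blast
  have "S2_to_CP1 p \<in> CP1" for p
    unfolding S2_to_CP1_def by (simp add: *)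
  moreover have "l \<in> S2_to_CP1 ` S2" if "l \<in> CP1" for l
  proof -
    obtain a b where ab: "(a, b) \<noteq> (0, 0)" "l = homog a b" using \<open>l \<in> CP1\<close> by (auto simp: CP1_def)
    define r where "r = norm (a, b)"
    have r2: "r\<^sup>2 = (cmod a)\<^sup>2 + (cmod b)\<^sup>2"
      by (simp add: r_def norm_Pair)
    have r: "r > 0"
      using ab(1) unfolding r_def zero_less_norm_iff zero_prod_def .
    have "(cmod (a / r))\<^sup>2 + (cmod (b / r))\<^sup>2 = r\<^sup>2 / r\<^sup>2"
      unfolding r2 add_divide_distrib using r by (simp add: norm_divide power_divide r2)
    then have S3: "(a / r, b / r) \<in> S3"
      using r by (simp add: S3_def)
    have "homog (a / r) (b / r) = l"
      unfolding ab(2) using ab(1) r by (subst homog_eq_iff) auto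
    then show ?thesis
      unfolding image_iff using S2_to_CP1_hopf_coordinates[OF S3] by (intro bexI) simp_all
  qed
  ultimately show ?thesis
    unfolding bij_betw_def using inj_on_S2_to_CP1 by blast
qed

lemma hopf_map_eq:
  assumes "(z1, z2) \<in> S3"
  shows "hopf_map (z1, z2) =
    vector [2 * Re (z1 * cnj z2), 2 * Im (z1 * cnj z2), (cmod z1)\<^sup>2 - (cmod z2)\<^sup>2]"
  unfolding hopf_map_def case_prod_conv
  by (rule inv_into_f_eq[OF inj_on_S2_to_CP1 S2_to_CP1_hopf_coordinates[OF assms]])

text \<open>The usual fibre coordinates of the Hopf bundle are \<open>z\<^sub>1/|z\<^sub>1|\<close> over \<open>V\<^sub>N = {z\<^sub>1 \<noteq> 0}\<close> and
  \<open>z\<^sub>2/|z\<^sub>2|\<close> over \<open>V\<^sub>S = {z\<^sub>2 \<noteq> 0}\<close>. In the index convention of \<^const>\<open>U1_transition_functions\<close>, the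
  usual transition function \<open>z\<^sub>1/z\<^sub>2 |z\<^sub>2/z\<^sub>1|\<close> of \<open>[z\<^sub>1 : z\<^sub>2]\<close> is the one leading from \<open>V\<^sub>S\<close> to
  \<open>V\<^sub>N\<close>.\<close>

lemma hopf_transition_function:
  assumes "z1 \<noteq> 0" "z2 \<noteq> 0"
  shows "z1 / cmod z1 = (z1 / z2 * cmod (z2 / z1)) * (z2 / cmod z2)"
  using assms by (simp add: norm_divide)


section \<open>The categorical Hopf map\<close>

definition hopf_V :: "nat \<Rightarrow> (real^3) set" where
  "hopf_V i = {p \<in> S2.
     if i = 1 then p$1 > 0 else if i = 2 then p$1 < 0 else
     if i = 3 then p$2 > 0 else if i = 4 then p$2 < 0 else
     if i = 5 then p$3 > 0 else i = 6 \<and> p$3 < 0}"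

text \<open>\<open>hopf_g5 i\<close> is \<open>g\<^sub>i\<^sub>5\<close> for \<open>i = 1, 2, 3, 4\<close>. On \<open>V\<^sub>i \<inter> V\<^sub>5\<close> the arguments of \<open>arcsin\<close> and \<open>arccos\<close>
  lie in the open interval \<open>(-1, 1)\<close>.\<close>

definition hopf_g5 :: "nat \<Rightarrow> real^3 \<Rightarrow> real" where
  "hopf_g5 i p = (let \<rho> = sqrt ((p$1)\<^sup>2 + (p$2)\<^sup>2) in
     if i = 1 then 1 / (2 * pi) * arcsin (p$2 / \<rho>) else
     if i = 2 then 1 / (2 * pi) * arcsin (- p$2 / \<rho>) + 1 / 2 else
     if i = 3 then 1 / (2 * pi) * arccos (p$1 / \<rho>) else
     if i = 4 then 1 / (2 * pi) * arccos (- p$1 / \<rho>) + 1 / 2 else 0)"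

definition hopf_g :: "nat \<Rightarrow> nat \<Rightarrow> real^3 \<Rightarrow> real" where
  "hopf_g i j p =
     (if i \<in> {1..4} \<and> j = 5 then hopf_g5 i p else
      if i = 5 \<and> j \<in> {1..4} then - hopf_g5 j p else 0)"

definition RZ_rel :: "(real \<times> real) set" where
  "RZ_rel = {(x, y). x - y \<in> \<int>}"

definition RZ :: "real set set" where
  "RZ = UNIV // RZ_rel"

definition hopf_h :: "nat \<Rightarrow> nat \<Rightarrow> nat \<Rightarrow> real^3 \<Rightarrow> real \<times> real set" where
  "hopf_h i j k p = (hopf_g i k p - hopf_g i j p - hopf_g j k p, RZ_rel `` {0})"

definition F0 :: "real \<Rightarrow> complex" where
  "F0 r = Complex (cos (2 * pi * r)) (sin (2 * pi * r))"

text \<open>The trivial map \<open>\<int> \<times> \<real>/\<int> \<rightarrow> {1}\<close>, with \<open>\<int>\<close> as a subset of \<open>\<real>\<close>. Outside its domain it has the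
  dummy value \<open>0\<close>, so that \<open>F1 (hopf_h i j k p) = 1\<close> entails \<open>hopf_h i j k p \<in> \<int> \<times> \<real>/\<int>\<close>.\<close>

definition F1 :: "real \<times> real set \<Rightarrow> complex" where
  "F1 x = (if x \<in> \<int> \<times> RZ then 1 else 0)"

end

theory Submission
  imports Defs
begin

text \<open>The coordinates \<open>z\<^sub>1 / |z\<^sub>1|\<close> and \<open>z\<^sub>2 / |z\<^sub>2|\<close> trivialise the Hopf bundle away from the south pole
  and away from the north pole, respectively. The upper hemisphere \<open>V\<^sub>5\<close> misses the south pole and
  every other \<open>V\<^sub>i\<close> misses the north pole; so \<open>V\<^sub>5\<close> gets the first coordinate and all other members of
  the cover get the second. Since \<open>X + iY = 2 z\<^sub>1 * cnj z\<^sub>2\<close>, the first coordinate divided by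
  the second is the direction \<open>(X + iY) / \<rho>\<close> of the base point. The functions \<open>g\<^sub>i\<^sub>5\<close> are branches of the polar angle of \<open>X + iY\<close>, in units of full turns, and \<open>F0\<close> turns them into this
  direction (\<open>F0_hopf_g5\<close>). Between two members of the cover that use the same coordinate the
  transition function is \<open>1\<close>, in accordance with \<open>g\<^sub>i\<^sub>j = 0\<close>; and \<open>V\<^sub>5 \<inter> V\<^sub>6\<close> is empty. This gives
  \<open>fibre_coordinate_transition\<close>.

  The cocycle identity follows from this without a case distinction: every point of \<open>S\<^sup>2\<close> has a point \<open>z\<close>
  above it, and \<open>g'\<^sub>i\<^sub>j\<close> is the quotient of the \<open>j\<close>-th by the \<open>i\<close>-th coordinate of \<open>z\<close>
  (\<open>F0_hopf_g_cocycle\<close>). The identity in turn forces \<open>g\<^sub>i\<^sub>k - g\<^sub>i\<^sub>j - g\<^sub>j\<^sub>k\<close> to be an integer, because the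
  kernel of \<open>F0\<close> is \<open>\<int>\<close>.

  A trivialisation is a diffeomorphism because both it and its inverse have closed formulas that
  involve only algebraic operations and square roots of positive functions
  (\<open>U1_local_trivialisation_from_section\<close>). The closure of \<open>C\<^sup>n\<close> maps under these operations is
  proved by induction on \<open>n\<close>.\<close>


section \<open>Calculus of smooth maps\<close>

lemma Ck_on_SucI:
  assumes "\<And>x. x \<in> U \<Longrightarrow> (f has_derivative f' x) (at x)" "\<And>v. Ck_on n U (\<lambda>x. f' x v)"
  shows "Ck_on (Suc n) U f"
  using assms by auto

lemma Ck_on_Suc_imp:
  "Ck_on (Suc n) U f \<Longrightarrow> Ck_on n U f"
proof (induction n arbitrary: f)
  case 0
  then show ?case
    by (auto intro!: continuous_at_imp_continuous_on) (blast intro: has_derivative_continuous)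
next
  case (Suc n)
  from Suc.prems obtain f' where
    f': "\<And>x. x \<in> U \<Longrightarrow> (f has_derivative f' x) (at x)" "\<And>v. Ck_on (Suc n) U (\<lambda>x. f' x v)"
    by auto
  show ?case
    by (rule Ck_on_SucI[where f' = f']) (auto intro: f'(1) Suc.IH[OF f'(2)] simp del: Ck_on.simps)
qed

lemma Ck_on_cong:
  assumes "open U" "\<And>x. x \<in> U \<Longrightarrow> f x = g x" "Ck_on n U g"
  shows "Ck_on n U f"
proof (cases n)
  case 0
  then show ?thesis using assms continuous_on_cong[of U U f g] by simp
next
  case (Suc m)
  with assms(3) obtain g' where g': "\<And>x. x \<in> U \<Longrightarrow> (g has_derivative g' x) (at x)"
    "\<And>v. Ck_on m U (\<lambda>x. g' x v)"
    by auto
  have "(f has_derivative g' x) (at x)" if "x \<in> U" for x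
    using has_derivative_transform_within_open[OF g'(1)[OF that] assms(1) that] assms(2)
    by simp
  then show ?thesis unfolding Suc using g'(2) by (intro Ck_on_SucI)
qed

lemma Ck_on_const: "Ck_on n U (\<lambda>x. c)"
  by (induction n arbitrary: c) (auto intro!: Ck_on_SucI derivative_eq_intros simp del: Ck_on.simps(2))

lemma Ck_on_ident: "Ck_on n U (\<lambda>x. x)"
proof (cases n)
  case (Suc m)
  then show ?thesis
    by (auto intro!: Ck_on_SucI[where f' = "\<lambda>x v. v"] Ck_on_const simp del: Ck_on.simps(2))
qed simp

lemma Ck_on_linear:
  assumes L: "bounded_linear L"
  shows "Ck_on n U f \<Longrightarrow> Ck_on n U (\<lambda>x. L (f x))"
proof (induction n arbitrary: f)
  case 0
  then show ?case using bounded_linear.continuous_on[OF L] by simp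
next
  case (Suc n)
  from Suc.prems obtain f' where
    f': "\<And>x. x \<in> U \<Longrightarrow> (f has_derivative f' x) (at x)" "\<And>v. Ck_on n U (\<lambda>x. f' x v)"
    by auto
  show ?case
    by (rule Ck_on_SucI[where f' = "\<lambda>x v. L (f' x v)"])
      (auto intro: bounded_linear.has_derivative[OF L] f' Suc.IH)
qed

lemma Ck_on_add:
  "Ck_on n U f \<Longrightarrow> Ck_on n U g \<Longrightarrow> Ck_on n U (\<lambda>x. f x + g x)"
proof (induction n arbitrary: f g)
  case 0
  then show ?case by (auto intro: continuous_on_add)
next
  case (Suc n)
  obtain f' where
    f': "\<And>x. x \<in> U \<Longrightarrow> (f has_derivative f' x) (at x)" "\<And>v. Ck_on n U (\<lambda>x. f' x v)"
    using Suc.prems(1) by auto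
  obtain g' where
    g': "\<And>x. x \<in> U \<Longrightarrow> (g has_derivative g' x) (at x)" "\<And>v. Ck_on n U (\<lambda>x. g' x v)"
    using Suc.prems(2) by auto
  show ?case
    by (rule Ck_on_SucI[where f' = "\<lambda>x v. f' x v + g' x v"])
      (auto intro: has_derivative_add f' g' Suc.IH)
qed

text \<open>The derivative \<open>B (f x) (g' x v) + B (f' x v) (g x)\<close> is built from the same bilinear map, which
  is why the induction hypothesis, stated for all \<open>f\<close> and \<open>g\<close>, applies to it.\<close>

lemma Ck_on_bilinear:
  assumes B: "bounded_bilinear B"
  shows "Ck_on n U f \<Longrightarrow> Ck_on n U g \<Longrightarrow> Ck_on n U (\<lambda>x. B (f x) (g x))"
proof (induction n arbitrary: f g)
  case 0
  then show ?case using bounded_bilinear.continuous_on[OF B] by auto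
next
  case (Suc n)
  obtain f' where
    f': "\<And>x. x \<in> U \<Longrightarrow> (f has_derivative f' x) (at x)" "\<And>v. Ck_on n U (\<lambda>x. f' x v)"
    using Suc.prems(1) by auto
  obtain g' where
    g': "\<And>x. x \<in> U \<Longrightarrow> (g has_derivative g' x) (at x)" "\<And>v. Ck_on n U (\<lambda>x. g' x v)"
    using Suc.prems(2) by auto
  note fg = Suc.prems[THEN Ck_on_Suc_imp]
  show ?case
    by (rule Ck_on_SucI[where f' = "\<lambda>x v. B (f x) (g' x v) + B (f' x v) (g x)"])
      (auto intro!: bounded_bilinear.FDERIV[OF B] Ck_on_add Suc.IH fg f' g')
qed

lemmas Ck_on_scaleR = Ck_on_bilinear[OF bounded_bilinear_scaleR]
lemmas Ck_on_mult = Ck_on_bilinear[OF bounded_bilinear_mult]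
lemmas Ck_on_minus = Ck_on_linear[OF bounded_linear_minus[OF bounded_linear_ident]]
lemmas Ck_on_fst = Ck_on_linear[OF bounded_linear_fst]
lemmas Ck_on_snd = Ck_on_linear[OF bounded_linear_snd]
lemmas Ck_on_Re = Ck_on_linear[OF bounded_linear_Re]
lemmas Ck_on_Im = Ck_on_linear[OF bounded_linear_Im]
lemmas Ck_on_cnj = Ck_on_linear[OF bounded_linear_cnj]
lemmas Ck_on_of_real = Ck_on_linear[OF bounded_linear_of_real]
lemmas Ck_on_vec_nth = Ck_on_linear[OF bounded_linear_vec_nth]

lemma Ck_on_diff:
  "Ck_on n U f \<Longrightarrow> Ck_on n U g \<Longrightarrow> Ck_on n U (\<lambda>x. f x - g x)"
  using Ck_on_add[OF _ Ck_on_minus, of n U f g] by simp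

lemma Ck_on_Pair:
  assumes "Ck_on n U f" "Ck_on n U g"
  shows "Ck_on n U (\<lambda>x. (f x, g x))"
proof -
  have *: "bounded_linear (\<lambda>y::'b. (y, 0::'c))" "bounded_linear (\<lambda>z::'c. (0::'b, z))"
    by (intro bounded_linear_Pair bounded_linear_ident bounded_linear_zero)+
  show ?thesis
    using Ck_on_add[OF Ck_on_linear[OF *(1) assms(1)] Ck_on_linear[OF *(2) assms(2)]] by simp
qed

lemma Ck_on_Complex:
  assumes "Ck_on n U f" "Ck_on n U g"
  shows "Ck_on n U (\<lambda>x. Complex (f x) (g x))"
  unfolding Complex_eq by (intro Ck_on_add Ck_on_mult Ck_on_const Ck_on_of_real assms)

lemma Ck_on_vector_3:
  fixes f g h :: "'a::euclidean_space \<Rightarrow> real"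
  assumes "Ck_on n U f" "Ck_on n U g" "Ck_on n U h"
  shows "Ck_on n U (\<lambda>x. vector [f x, g x, h x] :: real^3)"
proof -
  have *: "(vector [a, b, c] :: real^3) = a *\<^sub>R axis 1 1 + b *\<^sub>R axis 2 1 + c *\<^sub>R axis 3 1"
    for a b c :: real
    by (simp add: vec_eq_iff forall_3 axis_def)
  show ?thesis unfolding * by (intro Ck_on_add Ck_on_scaleR Ck_on_const assms)
qed

lemma Ck_on_cmod_power2:
  assumes "Ck_on n U f"
  shows "Ck_on n U (\<lambda>x. (cmod (f x))\<^sup>2)"
  unfolding cmod_power2 unfolding power2_eq_square
  by (intro Ck_on_add Ck_on_mult Ck_on_Re Ck_on_Im assms)

text \<open>All real exponents are treated at once because differentiation lowers the exponent by one:
  the induction on the order of differentiability passes from \<open>a\<close> to \<open>a - 1\<close>.\<close>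

lemma Ck_on_powr:
  fixes g :: "'a::euclidean_space \<Rightarrow> real"
  assumes pos: "\<And>x. x \<in> U \<Longrightarrow> g x > 0"
  shows "Ck_on n U g \<Longrightarrow> Ck_on n U (\<lambda>x. g x powr a)"
proof (induction n arbitrary: a)
  case 0
  have "\<forall>x\<in>U. g x \<noteq> 0" using pos by force
  with 0 show ?case by (auto intro!: continuous_intros)
next
  case (Suc n)
  obtain g' where
    g': "\<And>x. x \<in> U \<Longrightarrow> (g has_derivative g' x) (at x)" "\<And>v. Ck_on n U (\<lambda>x. g' x v)"
    using Suc.prems by auto
  show ?case
  proof (rule Ck_on_SucI)
    fix x assume "x \<in> U"
    have "((\<lambda>y. y powr a) has_derivative (*) (a * g x powr (a - 1))) (at (g x))"
      using has_real_derivative_powr[OF pos[OF \<open>x \<in> U\<close>], of a]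
      by (simp only: has_field_derivative_def)
    from has_derivative_compose[OF g'(1)[OF \<open>x \<in> U\<close>] this]
    show "((\<lambda>y. g y powr a) has_derivative (\<lambda>v. a * g x powr (a - 1) * g' x v)) (at x)" .
  next
    show "Ck_on n U (\<lambda>x. a * g x powr (a - 1) * g' x v)" for v
      by (intro Ck_on_mult Ck_on_const Suc.IH Ck_on_Suc_imp[OF Suc.prems] g')
  qed
qed

lemma Ck_on_sqrt:
  assumes "open U" "\<And>x. x \<in> U \<Longrightarrow> g x > 0" "Ck_on n U g"
  shows "Ck_on n U (\<lambda>x. sqrt (g x))"
  by (rule Ck_on_cong[OF assms(1) _ Ck_on_powr[OF assms(2,3), where a = "1 / 2"]])
    (use assms(2) in \<open>simp_all add: powr_half_sqrt less_imp_le\<close>)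

lemma Ck_on_inverse:
  fixes g :: "'a::euclidean_space \<Rightarrow> real"
  assumes "open U" "\<And>x. x \<in> U \<Longrightarrow> g x > 0" "Ck_on n U g"
  shows "Ck_on n U (\<lambda>x. inverse (g x))"
  by (rule Ck_on_cong[OF assms(1) _ Ck_on_powr[OF assms(2,3), where a = "-1"]])
    (use assms(2) in \<open>simp_all add: powr_minus less_imp_le\<close>)

text \<open>The norm enters only through its square, which is smooth also at zeros of \<open>f\<close>; away
  from the zeros it is positive, and the facts on roots and inverses of positive functions apply.\<close>

lemma Ck_on_sgn_complex:
  fixes f :: "'a::euclidean_space \<Rightarrow> complex"
  assumes "open U" "\<And>x. x \<in> U \<Longrightarrow> f x \<noteq> 0" "Ck_on n U f"
  shows "Ck_on n U (\<lambda>x. sgn (f x))"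
proof -
  have "sgn (f x) = inverse (sqrt ((cmod (f x))\<^sup>2)) *\<^sub>R f x" for x
    by (simp add: sgn_div_norm)
  then show ?thesis
    by (simp only:) (intro Ck_on_scaleR Ck_on_inverse Ck_on_sqrt Ck_on_cmod_power2 assms,
      simp_all add: assms(2))
qed

lemmas Ck_on_intros = Ck_on_const Ck_on_ident Ck_on_add Ck_on_diff Ck_on_minus Ck_on_mult
  Ck_on_Pair Ck_on_fst Ck_on_snd Ck_on_Re Ck_on_Im Ck_on_cnj Ck_on_of_real Ck_on_vec_nth
  Ck_on_Complex Ck_on_vector_3 Ck_on_cmod_power2

lemma smooth_map_onI:
  assumes "open U" "A \<subseteq> U" "\<And>n. Ck_on n U F" "\<And>x. x \<in> A \<Longrightarrow> f x = F x"
  shows "smooth_map_on A f"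
  unfolding smooth_map_on_def using assms by (metis IntD1 subsetD)

lemma smooth_map_on_cong:
  assumes "smooth_map_on A f" "\<And>x. x \<in> A \<Longrightarrow> g x = f x"
  shows "smooth_map_on A g"
  using assms unfolding smooth_map_on_def by (metis IntD1)


section \<open>Trivialisations from sections\<close>

text \<open>An equivariant fibre coordinate \<open>\<phi>\<close> and the section \<open>s\<close> on which it takes the value \<open>1\<close> carry the
  same information, and \<open>(x, u) \<mapsto> s x \<cdot> u\<close> inverts \<open>p \<mapsto> (\<pi> p, \<phi> p)\<close>. With both at hand the inverse
  is explicit, and its smoothness becomes a matter of inspecting a formula.\<close>

lemma U1_local_trivialisation_from_section:
  assumes smooth: "smooth_map_on {p \<in> P. \<pi> p \<in> W} (\<lambda>p. (\<pi> p, \<phi> p))"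
      "smooth_map_on (W \<times> U1) (\<lambda>(x, u). act (s x) u)"
    and equivariant: "\<And>p u. p \<in> P \<Longrightarrow> u \<in> U1 \<Longrightarrow> \<phi> (act p u) = \<phi> p * u"
    and act: "\<And>p u. p \<in> P \<Longrightarrow> u \<in> U1 \<Longrightarrow> act p u \<in> P \<and> \<pi> (act p u) = \<pi> p"
    and s: "\<And>x. x \<in> W \<Longrightarrow> s x \<in> P \<and> \<pi> (s x) = x \<and> \<phi> (s x) = 1"
    and \<phi>: "\<And>p. p \<in> P \<Longrightarrow> \<pi> p \<in> W \<Longrightarrow> \<phi> p \<in> U1 \<and> act (s (\<pi> p)) (\<phi> p) = p"
  shows "U1_local_trivialisation P act \<pi> W (\<lambda>p. (\<pi> p, \<phi> p))"
proof -
  let ?A = "{p \<in> P. \<pi> p \<in> W}" and ?\<psi> = "\<lambda>p. (\<pi> p, \<phi> p)" and ?\<sigma> = "\<lambda>(x, u). act (s x) u"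
  have bij: "bij_betw ?\<psi> ?A (W \<times> U1)"
    by (rule bij_betw_byWitness[where f' = ?\<sigma>]) (auto simp: act s \<phi> equivariant)
  have "inv_into ?A ?\<psi> y = ?\<sigma> y" if "y \<in> W \<times> U1" for y
    by (rule inv_into_f_eq) (use that bij in \<open>auto simp: bij_betw_def act s equivariant\<close>)
  with smooth(2) have "smooth_map_on (W \<times> U1) (inv_into ?A ?\<psi>)"
    by (rule smooth_map_on_cong)
  with bij smooth(1) show ?thesis
    by (auto simp: U1_local_trivialisation_def diffeomorphism_on_def equivariant)
qed


section \<open>The Hopf bundle\<close>

lemma hopf_map_nth:
  assumes "z \<in> S3"
  shows "hopf_map z $ 1 = 2 * Re (fst z * cnj (snd z))"
    "hopf_map z $ 2 = 2 * Im (fst z * cnj (snd z))"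
    "hopf_map z $ 3 = (cmod (fst z))\<^sup>2 - (cmod (snd z))\<^sup>2"
  using hopf_map_eq[of "fst z" "snd z"] assms by simp_all

lemma S3_iff: "z \<in> S3 \<longleftrightarrow> (cmod (fst z))\<^sup>2 + (cmod (snd z))\<^sup>2 = 1"
  by (cases z) (simp add: S3_def)

text \<open>These identities recover \<open>|z\<^sub>1|\<close> and \<open>|z\<^sub>2|\<close> from the height of the image point; the sections
  below are read off from them.\<close>

lemma hopf_map_3_eq:
  assumes "z \<in> S3"
  shows "1 - hopf_map z $ 3 = 2 * (cmod (snd z))\<^sup>2" "1 + hopf_map z $ 3 = 2 * (cmod (fst z))\<^sup>2"
  using assms by (simp_all add: hopf_map_nth S3_iff)

lemma hopf_map_horizontal:
  assumes "z \<in> S3"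
  shows "Complex (hopf_map z $ 1) (hopf_map z $ 2) = 2 * fst z * cnj (snd z)"
  using assms by (simp add: hopf_map_nth complex_eq_iff)

lemma hopf_map_in_S2: "z \<in> S3 \<Longrightarrow> hopf_map z \<in> S2"
  using S2_to_CP1_hopf_coordinates(1)[of "fst z" "snd z"] hopf_map_eq[of "fst z" "snd z"] by simp

lemma Ck_on_hopf_formula:
  "Ck_on n U (\<lambda>z::complex \<times> complex. vector [2 * Re (fst z * cnj (snd z)),
     2 * Im (fst z * cnj (snd z)), (cmod (fst z))\<^sup>2 - (cmod (snd z))\<^sup>2] :: real^3)"
  by (intro Ck_on_intros)

lemma hopf_map_eq_formula:
  "z \<in> S3 \<Longrightarrow> hopf_map z = vector [2 * Re (fst z * cnj (snd z)),
     2 * Im (fst z * cnj (snd z)), (cmod (fst z))\<^sup>2 - (cmod (snd z))\<^sup>2]"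
  using hopf_map_eq[of "fst z" "snd z"] by simp

lemma smooth_hopf_map: "smooth_map_on S3 hopf_map"
  by (rule smooth_map_onI[OF open_UNIV _ Ck_on_hopf_formula hopf_map_eq_formula]) auto

lemma hopf_action_eq: "hopf_action z u = (fst z * u, snd z * u)"
  by (simp add: hopf_action_def case_prod_beta)

lemma U1_mult_cnj: "u \<in> U1 \<Longrightarrow> u * cnj u = 1"
  by (simp add: U1_def complex_norm_square[symmetric])

lemma hopf_action_in_fibre:
  assumes "z \<in> S3" "u \<in> U1"
  shows "hopf_action z u \<in> S3" "hopf_map (hopf_action z u) = hopf_map z"
proof -
  from assms show S3: "hopf_action z u \<in> S3"
    by (simp add: S3_iff hopf_action_eq norm_mult U1_def)
  have "fst z * u * cnj (snd z * u) = fst z * cnj (snd z)"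
    using U1_mult_cnj[OF assms(2)] by (simp add: mult_ac)
  then have "fst (hopf_action z u) * cnj (snd (hopf_action z u)) = fst z * cnj (snd z)"
    by (simp only: hopf_action_eq fst_conv snd_conv)
  moreover have "cmod (fst (hopf_action z u)) = cmod (fst z)"
    "cmod (snd (hopf_action z u)) = cmod (snd z)"
    using assms(2) by (simp_all add: hopf_action_eq norm_mult U1_def)
  ultimately show "hopf_map (hopf_action z u) = hopf_map z"
    by (simp only: hopf_map_eq_formula S3 assms(1))
qed

text \<open>The point \<open>z\<close> of the fibre over \<open>x\<close> for which \<open>z\<^sub>2\<close> is a positive real: \<open>2 z\<^sub>2\<^sup>2 = 1 - x\<^sub>3\<close> determines
  \<open>z\<^sub>2\<close>, and then \<open>2 z\<^sub>1 z\<^sub>2 = x\<^sub>1 + i x\<^sub>2\<close> determines \<open>z\<^sub>1\<close>. It is smooth on \<open>S\<^sup>2\<close> without the north pole, which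
  includes the south pole.\<close>

definition south_section :: "real^3 \<Rightarrow> complex \<times> complex" where
  "south_section x = (let a = sqrt ((1 - x$3) / 2) in
     (of_real (inverse (2 * a)) * Complex (x$1) (x$2), of_real a))"

lemma sgn_mult_U1: "u \<in> U1 \<Longrightarrow> sgn (z * u) = sgn z * (u :: complex)"
  by (simp add: sgn_eq norm_mult U1_def)

lemma sgn_in_U1: "z \<noteq> 0 \<Longrightarrow> sgn z \<in> U1"
  by (simp add: U1_def norm_sgn)

lemma cmod_sgn_mult: "of_real (cmod z) * sgn z = z"
  by (cases "z = 0") (simp_all add: sgn_eq)

text \<open>This is \<open>z\<^sub>1\<close> of the point obtained by moving the section value \<open>(z\<^sub>1 cnj z\<^sub>2 / |z\<^sub>2|, |z\<^sub>2|)\<close> by the phase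
  of \<open>z\<^sub>2\<close>.\<close>

lemma cnj_mult_sgn:
  assumes "w \<noteq> 0"
  shows "of_real (inverse (cmod w)) * (z * cnj w) * sgn w = z"
proof -
  have "w * cnj w = of_real (cmod w) * of_real (cmod w)"
    by (simp add: complex_norm_square[symmetric] power2_eq_square[symmetric])
  then show ?thesis
    using assms by (simp add: sgn_eq divide_simps mult_ac)
qed

lemma south_section:
  assumes x: "x \<in> S2" "x$3 < 1"
  shows "south_section x \<in> S3" "hopf_map (south_section x) = x" "sgn (snd (south_section x)) = 1"
proof -
  define a where "a = sqrt ((1 - x$3) / 2)"
  have a: "a > 0" "2 * a\<^sup>2 = 1 - x$3" using x(2) by (simp_all add: a_def)
  have s: "south_section x = (of_real (inverse (2 * a)) * Complex (x$1) (x$2), of_real a)"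
    by (simp only: south_section_def a_def Let_def)
  have "(x$1)\<^sup>2 + (x$2)\<^sup>2 = (1 - x$3) * (1 + x$3)"
    using x(1) by (simp add: S2_iff algebra_simps power2_eq_square)
  also have "1 + x$3 = 2 * (1 - a\<^sup>2)"
    using a(2) by simp
  also have "(1 - x$3) * \<dots> = (2 * a)\<^sup>2 * (1 - a\<^sup>2)"
    unfolding a(2)[symmetric] by (simp add: power2_eq_square)
  finally have "(cmod (fst (south_section x)))\<^sup>2 = 1 - a\<^sup>2"
    using a(1) by (simp add: s norm_mult power_mult_distrib cmod_power2 power_inverse field_simps)
  moreover have "(cmod (snd (south_section x)))\<^sup>2 = a\<^sup>2"
    by (simp add: s)
  ultimately have S3: "south_section x \<in> S3"
    and 3: "(cmod (fst (south_section x)))\<^sup>2 - (cmod (snd (south_section x)))\<^sup>2 = x$3"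
    using a(2) by (simp_all add: S3_iff)
  have "fst (south_section x) * cnj (snd (south_section x)) = Complex (x$1 / 2) (x$2 / 2)"
    using a(1) by (simp add: s complex_eq_iff field_simps)
  with 3 S3 show "south_section x \<in> S3" "hopf_map (south_section x) = x"
    by (simp_all add: hopf_map_eq_formula vec_eq_iff forall_3)
  show "sgn (snd (south_section x)) = 1"
    using a(1) by (simp add: s sgn_of_real)
qed

lemma south_section_hopf_map:
  assumes "z \<in> S3" "snd z \<noteq> 0"
  shows "hopf_action (south_section (hopf_map z)) (sgn (snd z)) = z"
proof -
  have "sqrt ((1 - hopf_map z $ 3) / 2) = cmod (snd z)"
    using hopf_map_3_eq[OF assms(1)] by simp
  then have "south_section (hopf_map z) =
      (of_real (inverse (cmod (snd z))) * (fst z * cnj (snd z)), of_real (cmod (snd z)))"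
    by (simp add: south_section_def hopf_map_horizontal[OF assms(1)] Let_def)
  then show ?thesis
    by (simp add: hopf_action_eq cmod_sgn_mult cnj_mult_sgn[OF assms(2)] del: of_real_inverse)
qed

text \<open>Exchanging \<open>z\<^sub>1\<close> and \<open>z\<^sub>2\<close> covers the half turn of \<open>S\<^sup>2\<close> about the first axis, that is
  \<open>[z\<^sub>1 : z\<^sub>2] \<mapsto> [z\<^sub>2 : z\<^sub>1]\<close>, which exchanges the poles. Hence a section around the north pole is
  obtained from the one around the south pole.\<close>

definition half_turn :: "real^3 \<Rightarrow> real^3" where
  "half_turn x = vector [x$1, - x$2, - x$3]"

lemma half_turn_half_turn: "half_turn (half_turn x) = x"
  by (simp add: half_turn_def vec_eq_iff forall_3)

lemma half_turn_in_S2: "x \<in> S2 \<Longrightarrow> half_turn x \<in> S2"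
  by (simp add: half_turn_def S2_iff)

lemma swap_in_S3_iff: "prod.swap z \<in> S3 \<longleftrightarrow> z \<in> S3"
  by (simp add: S3_iff add.commute)

lemma hopf_map_swap: "z \<in> S3 \<Longrightarrow> hopf_map (prod.swap z) = half_turn (hopf_map z)"
  by (simp add: hopf_map_eq_formula swap_in_S3_iff half_turn_def vec_eq_iff forall_3 mult.commute)

lemma hopf_action_swap: "hopf_action (prod.swap z) u = prod.swap (hopf_action z u)"
  by (simp add: hopf_action_eq)

definition north_section :: "real^3 \<Rightarrow> complex \<times> complex" where
  "north_section x = prod.swap (south_section (half_turn x))"

lemma north_section:
  assumes x: "x \<in> S2" "x$3 > -1"
  shows "north_section x \<in> S3" "hopf_map (north_section x) = x" "sgn (fst (north_section x)) = 1"
proof -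
  have "half_turn x $ 3 < 1" using x(2) by (simp add: half_turn_def)
  note s = south_section[OF half_turn_in_S2[OF x(1)] this]
  show "north_section x \<in> S3" "hopf_map (north_section x) = x" "sgn (fst (north_section x)) = 1"
    using s by (simp_all add: north_section_def swap_in_S3_iff hopf_map_swap half_turn_half_turn)
qed

lemma north_section_hopf_map:
  assumes "z \<in> S3" "fst z \<noteq> 0"
  shows "hopf_action (north_section (hopf_map z)) (sgn (fst z)) = z"
  using south_section_hopf_map[of "prod.swap z"] assms
  by (simp add: north_section_def swap_in_S3_iff hopf_map_swap hopf_action_swap)

lemma hopf_map_3_less_iff: "z \<in> S3 \<Longrightarrow> hopf_map z $ 3 < 1 \<longleftrightarrow> snd z \<noteq> 0"
proof -
  assume "z \<in> S3"
  then have "hopf_map z $ 3 < 1 \<longleftrightarrow> 0 < 2 * (cmod (snd z))\<^sup>2"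
    unfolding hopf_map_3_eq(1)[OF \<open>z \<in> S3\<close>, symmetric] by auto
  then show ?thesis by simp
qed

lemma hopf_map_3_greater_iff: "z \<in> S3 \<Longrightarrow> hopf_map z $ 3 > -1 \<longleftrightarrow> fst z \<noteq> 0"
proof -
  assume "z \<in> S3"
  then have "hopf_map z $ 3 > -1 \<longleftrightarrow> 0 < 2 * (cmod (fst z))\<^sup>2"
    unfolding hopf_map_3_eq(2)[OF \<open>z \<in> S3\<close>, symmetric] by auto
  then show ?thesis by simp
qed

text \<open>The trivialisations are stated for arbitrary subsets \<open>W\<close> of the punctured sphere, so that one
  coordinate serves all members of the cover that avoid the pole.\<close>

lemma south_trivialisation:
  assumes W: "W \<subseteq> S2" "\<And>x. x \<in> W \<Longrightarrow> x$3 < 1"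
  shows "U1_local_trivialisation S3 hopf_action hopf_map W (\<lambda>z. (hopf_map z, sgn (snd z)))"
proof (rule U1_local_trivialisation_from_section[where s = south_section])
  have nonzero: "snd z \<noteq> 0" if "z \<in> S3" "hopf_map z \<in> W" for z
    using hopf_map_3_less_iff[OF that(1)] W(2)[OF that(2)] by simp
  show "smooth_map_on {z \<in> S3. hopf_map z \<in> W} (\<lambda>z. (hopf_map z, sgn (snd z)))"
  proof (rule smooth_map_onI)
    show U: "open {z::complex \<times> complex. snd z \<noteq> 0}"
      by (intro open_Collect_neq continuous_intros)
    show "Ck_on n {z. snd z \<noteq> 0} (\<lambda>z::complex \<times> complex. (vector [2 * Re (fst z * cnj (snd z)),
      2 * Im (fst z * cnj (snd z)), (cmod (fst z))\<^sup>2 - (cmod (snd z))\<^sup>2] :: real^3, sgn (snd z)))" for n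
      by (intro Ck_on_Pair Ck_on_hopf_formula Ck_on_sgn_complex U Ck_on_snd Ck_on_ident) simp
  qed (use nonzero in blast, simp only: hopf_map_eq_formula mem_Collect_eq)
  show "smooth_map_on (W \<times> U1) (\<lambda>(x, u). hopf_action (south_section x) u)"
  proof (rule smooth_map_onI)
    show V: "open {y::(real^3) \<times> complex. fst y $ 3 < 1}"
      by (intro open_Collect_less continuous_intros)
    show "Ck_on n {y. fst y $ 3 < 1} (\<lambda>y. hopf_action (south_section (fst y)) (snd y))" for n
      unfolding hopf_action_eq south_section_def Let_def fst_conv snd_conv divide_inverse
      by (intro Ck_on_intros Ck_on_inverse Ck_on_sqrt V) simp_all
  qed (use W(2) in auto)
  show "sgn (snd z) \<in> U1 \<and> hopf_action (south_section (hopf_map z)) (sgn (snd z)) = z"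
    if "z \<in> S3" "hopf_map z \<in> W" for z
    using nonzero[OF that] that by (simp add: sgn_in_U1 south_section_hopf_map)
  show "south_section x \<in> S3 \<and> hopf_map (south_section x) = x \<and> sgn (snd (south_section x)) = 1"
    if "x \<in> W" for x
    using that W by (intro conjI south_section) auto
qed (simp_all add: hopf_action_in_fibre, simp add: hopf_action_eq sgn_mult_U1)

lemma north_trivialisation:
  assumes W: "W \<subseteq> S2" "\<And>x. x \<in> W \<Longrightarrow> x$3 > -1"
  shows "U1_local_trivialisation S3 hopf_action hopf_map W (\<lambda>z. (hopf_map z, sgn (fst z)))"
proof (rule U1_local_trivialisation_from_section[where s = north_section])
  have nonzero: "fst z \<noteq> 0" if "z \<in> S3" "hopf_map z \<in> W" for z
    using hopf_map_3_greater_iff[OF that(1)] W(2)[OF that(2)] by simp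
  show "smooth_map_on {z \<in> S3. hopf_map z \<in> W} (\<lambda>z. (hopf_map z, sgn (fst z)))"
  proof (rule smooth_map_onI)
    show U: "open {z::complex \<times> complex. fst z \<noteq> 0}"
      by (intro open_Collect_neq continuous_intros)
    show "Ck_on n {z. fst z \<noteq> 0} (\<lambda>z::complex \<times> complex. (vector [2 * Re (fst z * cnj (snd z)),
      2 * Im (fst z * cnj (snd z)), (cmod (fst z))\<^sup>2 - (cmod (snd z))\<^sup>2] :: real^3, sgn (fst z)))" for n
      by (intro Ck_on_Pair Ck_on_hopf_formula Ck_on_sgn_complex U Ck_on_fst Ck_on_ident) simp
  qed (use nonzero in blast, simp only: hopf_map_eq_formula mem_Collect_eq)
  show "smooth_map_on (W \<times> U1) (\<lambda>(x, u). hopf_action (north_section x) u)"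
  proof (rule smooth_map_onI)
    show V: "open {y::(real^3) \<times> complex. fst y $ 3 > -1}"
      by (intro open_Collect_less continuous_intros)
    show "Ck_on n {y. fst y $ 3 > -1} (\<lambda>y. hopf_action (north_section (fst y)) (snd y))" for n
      unfolding hopf_action_eq north_section_def half_turn_def south_section_def vector_3
        fst_swap snd_swap Let_def fst_conv snd_conv divide_inverse
      by (intro Ck_on_intros Ck_on_inverse Ck_on_sqrt V) simp_all
  qed (use W(2) in auto)
  show "sgn (fst z) \<in> U1 \<and> hopf_action (north_section (hopf_map z)) (sgn (fst z)) = z"
    if "z \<in> S3" "hopf_map z \<in> W" for z
    using nonzero[OF that] that by (simp add: sgn_in_U1 north_section_hopf_map)
  show "north_section x \<in> S3 \<and> hopf_map (north_section x) = x \<and> sgn (fst (north_section x)) = 1"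
    if "x \<in> W" for x
    using that W by (intro conjI north_section) auto
qed (simp_all add: hopf_action_in_fibre, simp add: hopf_action_eq sgn_mult_U1)


section \<open>The cover and its transition functions\<close>

lemma F0_eq_cis: "F0 r = cis (2 * pi * r)"
  by (simp add: F0_def cis.code)

lemma F0_0: "F0 0 = 1"
  by (simp add: F0_eq_cis)

lemma F0_minus: "F0 (- r) = cnj (F0 r)"
  by (simp add: F0_eq_cis cis_cnj)

lemma F0_diff: "F0 (r - t) = F0 r / F0 t"
  by (simp add: F0_eq_cis cis_divide right_diff_distrib)

lemma F0_plus_half: "F0 (r + 1 / 2) = - F0 r"
  by (simp add: F0_def distrib_left complex_eq_iff)

lemma F0_in_U1: "F0 r \<in> U1"
  by (simp add: F0_eq_cis U1_def)

lemma F0_eq_1_imp_Ints: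
  assumes "F0 r = 1"
  shows "r \<in> \<int>"
proof -
  have "cos (2 * pi * r) = 1" using assms by (simp add: F0_def complex_eq_iff)
  then obtain n :: int where "2 * pi * r = of_int n * 2 * pi"
    by (auto simp: cos_one_2pi_int)
  then have "r = of_int n" by simp
  then show ?thesis by simp
qed

text \<open>The arcsine is the polar angle on the right half of the circle and the arccosine on its upper
  half. The left and lower halves follow by a half turn (\<open>F0_plus_half\<close>).\<close>

lemma F0_arcsin:
  assumes "c\<^sup>2 + s\<^sup>2 = 1" "c > 0"
  shows "F0 (1 / (2 * pi) * arcsin s) = Complex c s"
proof -
  have s: "\<bar>s\<bar> \<le> 1" unfolding abs_square_le_1[symmetric] using assms(1) zero_le_power2[of c] by linarith
  have "1 - s\<^sup>2 = c\<^sup>2" using assms(1) by simp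
  with s assms(2) show ?thesis by (simp add: F0_def cos_arcsin abs_le_iff)
qed

lemma F0_arccos:
  assumes "c\<^sup>2 + s\<^sup>2 = 1" "s > 0"
  shows "F0 (1 / (2 * pi) * arccos c) = Complex c s"
proof -
  have c: "\<bar>c\<bar> \<le> 1" unfolding abs_square_le_1[symmetric] using assms(1) zero_le_power2[of s] by linarith
  have "1 - c\<^sup>2 = s\<^sup>2" using assms(1) by simp
  with c assms(2) show ?thesis by (simp add: F0_def sin_arccos abs_le_iff)
qed

lemma hopf_V_horizontal:
  assumes "i \<in> {1..4}" "x \<in> hopf_V i"
  shows "Complex (x$1) (x$2) \<noteq> 0"
  using assms by (auto simp: hopf_V_def complex_eq_iff split: if_splits)

text \<open>The four functions are branches of one angle, so that \<open>F0\<close> makes them agree wherever they are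
  defined: dividing by \<open>\<rho>\<close> moves \<open>(x\<^sub>1, x\<^sub>2)\<close> to the unit circle, and the half plane that defines \<open>V\<^sub>i\<close> is
  the one on which the formula for \<open>g\<^sub>i\<^sub>5\<close> yields the polar angle.\<close>

lemma F0_hopf_g5:
  assumes i: "i \<in> {1..4}" and x: "x \<in> hopf_V i"
  shows "F0 (hopf_g5 i x) = sgn (Complex (x$1) (x$2))"
proof -
  define \<rho> where "\<rho> = sqrt ((x$1)\<^sup>2 + (x$2)\<^sup>2)"
  define c s where "c = x$1 / \<rho>" and "s = x$2 / \<rho>"
  have \<rho>: "\<rho> = cmod (Complex (x$1) (x$2))" by (simp add: \<rho>_def complex_norm)
  then have pos: "\<rho> > 0" using hopf_V_horizontal[OF assms] by simp
  have sgn: "sgn (Complex (x$1) (x$2)) = Complex c s"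
    unfolding sgn_eq \<rho>[symmetric] by (simp add: c_def s_def complex_eq_iff)
  have "c\<^sup>2 + s\<^sup>2 = \<rho>\<^sup>2 / \<rho>\<^sup>2"
    unfolding c_def s_def power_divide add_divide_distrib[symmetric] by (simp add: \<rho>_def)
  then have circle: "c\<^sup>2 + s\<^sup>2 = 1" using pos by simp
  consider "i = 1" "c > 0" | "i = 2" "- c > 0" | "i = 3" "s > 0" | "i = 4" "- s > 0"
  proof -
    have "i = 1 \<or> i = 2 \<or> i = 3 \<or> i = 4" using i by auto
    then show thesis
      using x pos that by (auto simp: hopf_V_def c_def s_def divide_less_0_iff)
  qed
  then have "F0 (hopf_g5 i x) = Complex c s"
  proof cases
    case 1
    then show ?thesis using F0_arcsin[OF circle] by (simp add: hopf_g5_def s_def \<rho>_def)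
  next
    case 2
    then have "F0 (1 / (2 * pi) * arcsin (- s) + 1 / 2) = Complex c s"
      unfolding F0_plus_half by (subst F0_arcsin[of "- c"]) (use circle in \<open>simp_all add: complex_eq_iff\<close>)
    with 2 show ?thesis by (simp add: hopf_g5_def s_def \<rho>_def)
  next
    case 3
    then show ?thesis using F0_arccos[OF circle] by (simp add: hopf_g5_def c_def \<rho>_def)
  next
    case 4
    then have "F0 (1 / (2 * pi) * arccos (- c) + 1 / 2) = Complex c s"
      unfolding F0_plus_half by (subst F0_arccos[of _ "- s"]) (use circle in \<open>simp_all add: complex_eq_iff\<close>)
    with 4 show ?thesis by (simp add: hopf_g5_def c_def \<rho>_def)
  qed
  with sgn show ?thesis by simp
qed

definition fibre_coordinate :: "nat \<Rightarrow> complex \<times> complex \<Rightarrow> complex" where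
  "fibre_coordinate i z = (if i = 5 then sgn (fst z) else sgn (snd z))"

lemma hopf_V_subset: "hopf_V i \<subseteq> S2"
  by (auto simp: hopf_V_def)

lemma hopf_V_5_north: "x \<in> hopf_V 5 \<Longrightarrow> x$3 > -1"
  by (simp add: hopf_V_def)

text \<open>The only point of \<open>S\<^sup>2\<close> with third coordinate at least \<open>1\<close> is the north pole, where the other
  two coordinates vanish.\<close>

lemma hopf_V_not_5_south:
  assumes "x \<in> hopf_V i" "i \<noteq> 5"
  shows "x$3 < 1"
proof (rule ccontr)
  assume "\<not> x$3 < 1"
  then have "1 \<le> (x$3)\<^sup>2" by simp
  moreover have "(x$1)\<^sup>2 + (x$2)\<^sup>2 + (x$3)\<^sup>2 = 1" using assms by (simp add: hopf_V_def S2_iff)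
  ultimately have "(x$1)\<^sup>2 + (x$2)\<^sup>2 \<le> 0" by simp
  then have "x$1 = 0" "x$2 = 0" by (simp_all add: sum_power2_le_zero_iff)
  with assms \<open>\<not> x$3 < 1\<close> show False by (simp add: hopf_V_def split: if_splits)
qed

lemma openin_hopf_V:
  assumes "i \<in> {1..6}"
  shows "openin (top_of_set S2) (hopf_V i)"
proof -
  have halves: "open {p::real^3. p$k > 0}" "open {p::real^3. p$k < 0}" for k
    by (intro open_Collect_less continuous_intros)+
  have "i = 1 \<or> i = 2 \<or> i = 3 \<or> i = 4 \<or> i = 5 \<or> i = 6" using assms by auto
  then have "\<exists>k. hopf_V i = S2 \<inter> {p. p$k > 0} \<or> hopf_V i = S2 \<inter> {p. p$k < 0}"
    by (elim disjE) (simp_all add: hopf_V_def Collect_conj_eq, blast+)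
  then show ?thesis using openin_open_Int[OF halves(1)] openin_open_Int[OF halves(2)] by metis
qed

lemma hopf_V_cover: "(\<Union>i\<in>{1..6}. hopf_V i) = S2"
proof (intro equalityI subsetI)
  fix x assume x: "x \<in> S2"
  then have "x$1 \<noteq> 0 \<or> x$2 \<noteq> 0 \<or> x$3 \<noteq> 0" by (auto simp: S2_iff)
  then consider "x$1 > 0" | "x$1 < 0" | "x$2 > 0" | "x$2 < 0" | "x$3 > 0" | "x$3 < 0"
    by linarith
  then have "x \<in> hopf_V 1 \<or> x \<in> hopf_V 2 \<or> x \<in> hopf_V 3 \<or> x \<in> hopf_V 4 \<or> x \<in> hopf_V 5 \<or> x \<in> hopf_V 6"
    by cases (simp_all add: hopf_V_def x)
  then show "x \<in> (\<Union>i\<in>{1..6}. hopf_V i)"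
    unfolding UN_iff by (elim disjE) (rule bexI, assumption, simp)+
qed (use hopf_V_subset in blast)

lemma hopf_V_trivialisation:
  "U1_local_trivialisation S3 hopf_action hopf_map (hopf_V i) (\<lambda>z. (hopf_map z, fibre_coordinate i z))"
proof (cases "i = 5")
  case True
  then show ?thesis
    using north_trivialisation[OF hopf_V_subset hopf_V_5_north] by (simp add: fibre_coordinate_def)
next
  case False
  then show ?thesis
    using south_trivialisation[OF hopf_V_subset hopf_V_not_5_south] by (simp add: fibre_coordinate_def)
qed

lemma fibre_coordinate_nonzero:
  assumes "z \<in> S3" "hopf_map z \<in> hopf_V i"
  shows "fibre_coordinate i z \<noteq> 0"
  using assms hopf_V_5_north[of "hopf_map z"] hopf_V_not_5_south[of "hopf_map z" i]
  by (auto simp: fibre_coordinate_def sgn_zero_iff hopf_map_3_less_iff hopf_map_3_greater_iff)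

lemma hopf_map_section:
  assumes "x \<in> S2"
  obtains z where "z \<in> S3" "hopf_map z = x"
  using north_section[OF assms] south_section[OF assms] by (cases "x$3 < 1") auto

lemma hopf_g_eq_0:
  assumes "\<not> (i \<in> {1..4} \<and> j = 5)" "\<not> (i = 5 \<and> j \<in> {1..4})"
  shows "hopf_g i j x = 0"
  using assms by (auto simp: hopf_g_def)

text \<open>Only pairs with exactly one index \<open>5\<close> change the coordinate, and then the other index is not \<open>6\<close>
  because \<open>V\<^sub>5\<close> and \<open>V\<^sub>6\<close> are disjoint. There \<open>z\<^sub>1 \<noteq> 0\<close> and \<open>z\<^sub>2 \<noteq> 0\<close>, and the phase of
  \<open>2 z\<^sub>1 * cnj z\<^sub>2\<close> is the phase of \<open>z\<^sub>1\<close> divided by that of \<open>z\<^sub>2\<close>.\<close>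

lemma fibre_coordinate_transition:
  assumes ij: "i \<in> {1..6}" "j \<in> {1..6}" and z: "z \<in> S3" "hopf_map z \<in> hopf_V i" "hopf_map z \<in> hopf_V j"
  shows "fibre_coordinate j z = F0 (hopf_g i j (hopf_map z)) * fibre_coordinate i z"
proof -
  have g5: "F0 (hopf_g5 k (hopf_map z)) = sgn (fst z) * cnj (sgn (snd z))"
    if "k \<in> {1..4}" "hopf_map z \<in> hopf_V k" for k
    unfolding F0_hopf_g5[OF that] hopf_map_horizontal[OF z(1)] by (simp add: sgn_eq norm_mult)
  have unit: "sgn w * cnj (sgn w) = 1" if "w \<noteq> 0" for w :: complex
    using U1_mult_cnj[OF sgn_in_U1[OF that]] .
  consider "i \<in> {1..4}" "j = 5" | "i = 5" "j \<in> {1..4}"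
    | "i = 5 \<longleftrightarrow> j = 5" | "i = 5" "j = 6" | "i = 6" "j = 5"
    using ij by (cases "i = 5"; cases "j = 5"; cases "i = 6"; cases "j = 6") auto
  then show ?thesis
  proof cases
    case 1
    then have "snd z \<noteq> 0"
      using fibre_coordinate_nonzero[OF z(1,2)] by (auto simp: fibre_coordinate_def)
    with 1 show ?thesis
      using g5[OF 1(1) z(2)] unit[of "snd z"] by (simp add: hopf_g_def fibre_coordinate_def mult_ac)
  next
    case 2
    then have "fst z \<noteq> 0"
      using fibre_coordinate_nonzero[OF z(1,2)] by (auto simp: fibre_coordinate_def)
    with 2 show ?thesis
      using g5[OF 2(2) z(3)] unit[of "fst z"]
      by (simp add: hopf_g_def fibre_coordinate_def F0_minus mult_ac)
  next
    case 3
    then have "hopf_g i j (hopf_map z) = 0" by (intro hopf_g_eq_0) auto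
    with 3 show ?thesis by (simp add: F0_0 fibre_coordinate_def)
  qed (use z in \<open>simp_all add: hopf_V_def\<close>)
qed

text \<open>Over a common point \<open>z\<close> of the fibre, all three factors are quotients of coordinates of \<open>z\<close>, and
  the product telescopes.\<close>

lemma F0_hopf_g_cocycle:
  assumes "i \<in> {1..6}" "j \<in> {1..6}" "k \<in> {1..6}" "x \<in> hopf_V i \<inter> hopf_V j \<inter> hopf_V k"
  shows "F0 (hopf_g i j x) * F0 (hopf_g j k x) = F0 (hopf_g i k x)"
proof -
  have "x \<in> S2" using assms(4) hopf_V_subset by blast
  then obtain z where z: "z \<in> S3" "hopf_map z = x" by (rule hopf_map_section)
  then have "F0 (hopf_g i j x) * F0 (hopf_g j k x) * fibre_coordinate i z = fibre_coordinate k z"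
    "F0 (hopf_g i k x) * fibre_coordinate i z = fibre_coordinate k z"
    using assms fibre_coordinate_transition[of i j z] fibre_coordinate_transition[of j k z]
      fibre_coordinate_transition[of i k z] by (auto simp: mult_ac)
  moreover have "fibre_coordinate i z \<noteq> 0"
    using assms(4) z by (intro fibre_coordinate_nonzero) auto
  ultimately show ?thesis by (metis mult_right_cancel)
qed

text \<open>After \<open>F0\<close>, all branches \<open>g\<^sub>i\<^sub>5\<close> become one function, the direction of \<open>x\<^sub>1 + i x\<^sub>2\<close>, which
  is smooth on all of \<open>\<real>\<^sup>3\<close> minus the third axis.\<close>

lemma smooth_F0_hopf_g: "smooth_map_on (hopf_V i \<inter> hopf_V j) (\<lambda>x. F0 (hopf_g i j x))"
proof -
  let ?U = "{x::real^3. Complex (x$1) (x$2) \<noteq> 0}"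
  have "?U = {x. x$1 \<noteq> 0} \<union> {x. x$2 \<noteq> 0}" by (auto simp: complex_eq_iff)
  moreover have "open {x::real^3. x$k \<noteq> 0}" for k by (intro open_Collect_neq continuous_intros)
  ultimately have U: "open ?U" by auto
  have smooth: "Ck_on n ?U (\<lambda>x. sgn (Complex (x$1) (x$2)))" for n
    by (intro Ck_on_sgn_complex U Ck_on_Complex Ck_on_vec_nth Ck_on_ident) simp
  consider "i \<in> {1..4}" "j = 5" | "i = 5" "j \<in> {1..4}"
    | "\<not> (i \<in> {1..4} \<and> j = 5)" "\<not> (i = 5 \<and> j \<in> {1..4})" by blast
  then show ?thesis
  proof cases
    case 1
    show ?thesis
      by (rule smooth_map_onI[OF U _ smooth])
        (use 1 hopf_V_horizontal[OF 1(1)] F0_hopf_g5[OF 1(1)] in \<open>auto simp: hopf_g_def\<close>)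
  next
    case 2
    show ?thesis
      by (rule smooth_map_onI[OF U _ Ck_on_cnj[OF smooth]])
        (use 2 hopf_V_horizontal[OF 2(2)] F0_hopf_g5[OF 2(2)] in \<open>auto simp: hopf_g_def F0_minus\<close>)
  next
    case 3
    show ?thesis
      by (rule smooth_map_onI[OF open_UNIV _ Ck_on_const]) (simp_all add: hopf_g_eq_0[OF 3])
  qed
qed

text \<open>The value \<open>1\<close> says that \<open>h\<^sub>i\<^sub>j\<^sub>k\<close> has its values in \<open>\<int> \<times> \<real>/\<int>\<close>, the domain of \<open>F1\<close>. Integrality is the
  cocycle identity of the exponentials, since \<open>F0 r = 1\<close> only for integers \<open>r\<close>.\<close>

lemma F1_hopf_h:
  assumes "i \<in> {1..6}" "j \<in> {1..6}" "k \<in> {1..6}" "x \<in> hopf_V i \<inter> hopf_V j \<inter> hopf_V k"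
  shows "F1 (hopf_h i j k x) = 1"
proof -
  have "F0 (hopf_g i k x - hopf_g i j x - hopf_g j k x) = 1"
    unfolding F0_diff F0_hopf_g_cocycle[OF assms, symmetric] by (simp add: F0_eq_cis)
  then show ?thesis
    by (auto simp: F1_def hopf_h_def RZ_def intro: quotientI dest: F0_eq_1_imp_Ints)
qed

lemma principal_hopf_bundle: "principal_U1_bundle S3 hopf_action hopf_map S2"
  unfolding principal_U1_bundle_def
proof (intro conjI ballI)
  show "hopf_map ` S3 = S2"
    using hopf_map_in_S2 by (auto elim: hopf_map_section)
  show "smooth_map_on S3 hopf_map" by (rule smooth_hopf_map)
  show "smooth_map_on (S3 \<times> U1) (\<lambda>(p, u). hopf_action p u)"
  proof (rule smooth_map_onI[OF open_UNIV])
    show "Ck_on n UNIV (\<lambda>y. hopf_action (fst y) (snd y))" for n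
      unfolding hopf_action_eq by (intro Ck_on_intros)
  qed auto
next
  fix x assume "x \<in> S2"
  then obtain i where "i \<in> {1..6}" "x \<in> hopf_V i" using hopf_V_cover by blast
  then show "\<exists>W \<psi>. openin (top_of_set S2) W \<and> x \<in> W \<and>
      U1_local_trivialisation S3 hopf_action hopf_map W \<psi>"
    using openin_hopf_V hopf_V_trivialisation by blast
qed (simp_all add: hopf_action_in_fibre, simp_all add: hopf_action_eq mult_ac)

theorem proposition5p5:
  fixes g' :: "nat \<Rightarrow> nat \<Rightarrow> real^3 \<Rightarrow> complex"
    and h' :: "nat \<Rightarrow> nat \<Rightarrow> nat \<Rightarrow> real^3 \<Rightarrow> complex"
  assumes "\<And>i j. g' i j = F0 \<circ> hopf_g i j"
    and "\<And>i j k. h' i j k = F1 \<circ> hopf_h i j k"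
  shows "U1_cocycle_data S2 {1..6} hopf_V g' h'
    \<and> principal_U1_bundle S3 hopf_action hopf_map S2
    \<and> U1_transition_functions S3 hopf_action hopf_map {1..6} hopf_V g'"
proof (intro conjI)
  have g': "g' i j = (\<lambda>x. F0 (hopf_g i j x))" for i j by (simp add: assms(1) comp_def)
  have h': "h' i j k x = 1"
    if "i \<in> {1..6}" "j \<in> {1..6}" "k \<in> {1..6}" "x \<in> hopf_V i \<inter> hopf_V j \<inter> hopf_V k" for i j k x
    using F1_hopf_h[OF that] by (simp add: assms(2))
  show "U1_cocycle_data S2 {1..6} hopf_V g' h'"
    unfolding U1_cocycle_data_def
  proof (intro conjI ballI)
    fix i j k :: nat assume ijk: "i \<in> {1..6}" "j \<in> {1..6}" "k \<in> {1..6}"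
    show "h' i j k \<in> hopf_V i \<inter> hopf_V j \<inter> hopf_V k \<rightarrow> {1}"
      by (intro funcsetI) (simp add: h'[OF ijk])
    show "smooth_map_on (hopf_V i \<inter> hopf_V j \<inter> hopf_V k) (h' i j k)"
      by (rule smooth_map_onI[OF open_UNIV subset_UNIV Ck_on_const h'[OF ijk]])
    show "g' i j x * g' j k x = g' i k x" if "x \<in> hopf_V i \<inter> hopf_V j \<inter> hopf_V k" for x
      unfolding g' by (rule F0_hopf_g_cocycle[OF ijk that])
  next
    fix i :: nat and x :: "real^3"
    show "(\<Union>i\<in>{1..6}. hopf_V i) = S2" by (rule hopf_V_cover)
    show "g' i i x = 1" by (simp add: g' hopf_g_eq_0 F0_0)
  qed (simp_all add: g' openin_hopf_V F0_in_U1 smooth_F0_hopf_g)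
  show "principal_U1_bundle S3 hopf_action hopf_map S2" by (rule principal_hopf_bundle)
  show "U1_transition_functions S3 hopf_action hopf_map {1..6} hopf_V g'"
    unfolding U1_transition_functions_def
  proof (intro exI[of _ "\<lambda>i z. (hopf_map z, fibre_coordinate i z)"] conjI ballI impI)
    fix i j z
    assume "i \<in> {1..6}" "j \<in> {1..6}" "z \<in> S3" "hopf_map z \<in> hopf_V i \<inter> hopf_V j"
    then show "snd (hopf_map z, fibre_coordinate j z)
        = g' i j (hopf_map z) * snd (hopf_map z, fibre_coordinate i z)"
      unfolding snd_conv g' by (intro fibre_coordinate_transition) auto
  qed (rule hopf_V_trivialisation)
qed

end
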